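(* Let $1\le p<\infty$ and let $\{(X_n,d_n)\}_{n=1}^\infty$ and $\{(Y_n,\varrho_n)\}_{n=1}^\infty$ be sequences of nonempty metric spaces such that $\sum_{n=1}^\infty(\operatorname{diam}(X_n))^p<\infty$ and $\sum_{n=1}^\infty(\operatorname{diam}(Y_n))^p<\infty$. Then $$d_{GH}^{c}\Bigl((l^p)\prod_{n=1}^\infty X_n,\ (l^p)\prod_{n=1}^\infty Y_n\Bigr)\le\Bigl(\sum_{n=1}^\infty\bigl(d_{GH}^{c}(X_n,Y_n)\bigr)^p\Bigr)^{1/p}.$$
   Context: $\operatorname{diam}(X)=\sup_{x,y\in X}d_X(x,y)$. For metric spaces $X,Y$ and maps $f\colon X\to Y$, $g\colon Y\to X$ put $\operatorname{dis}(f)=\sup_{x,x'\in X}|d_X(x,x')-d_Y(f(x),f(x'))|$, $\operatorname{dis}(g)=\sup_{y,y'\in Y}|d_Y(y,y')-d_X(g(y),g(y'))|$, $\operatorname{codis}(f,g)=\sup_{x\in X,y\in Y}|d_X(x,g(y))-d_Y(f(x),y)|$. The continuous Gromov--Hausdorff distance is $d^c_{GH}(X,Y)=\frac12\inf_{f,g}\max\{\operatorname{dis}f,\operatorname{dis}g,\operatorname{codis}(f,g)\}$, the infimum being over all continuous maps $f\colon X\to Y$ and $g\colon Y\to X$. For a sequence $\{(X_n,d_n)\}_{n=1}^\infty$ of metric spaces with $\sum_n(\operatorname{diam}(X_n))^p<\infty$, the $l^p$-product $(l^p)\prod_nX_n$ is the Cartesian product $\prod_{n=1}^\infty X_n$ with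 metric $d(\{x_n\},\{y_n\})=\bigl(\sum_{n=1}^\infty d_n(x_n,y_n)^p\bigr)^{1/p}$. *)

theory Defs
  imports "HOL-Analysis.Analysis"
begin

(* All suprema and infima below are taken in [0, \<infinity>], so that they exist unconditionally. *)

definition mdiam :: "'a metric \<Rightarrow> ennreal" where
  "mdiam X = (SUP x\<in>mspace X. SUP x'\<in>mspace X. ennreal (mdist X x x'))"

definition dis :: "'a metric \<Rightarrow> 'b metric \<Rightarrow> ('a \<Rightarrow> 'b) \<Rightarrow> ennreal" where
  "dis X Y f = (SUP x\<in>mspace X. SUP x'\<in>mspace X.
     ennreal \<bar>mdist X x x' - mdist Y (f x) (f x')\<bar>)"

definition codis :: "'a metric \<Rightarrow> 'b metric \<Rightarrow> ('a \<Rightarrow> 'b) \<Rightarrow> ('b \<Rightarrow> 'a) \<Rightarrow> ennreal" where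
  "codis X Y f g = (SUP x\<in>mspace X. SUP y\<in>mspace Y.
     ennreal \<bar>mdist X x (g y) - mdist Y (f x) y\<bar>)"

definition dGHc :: "'a metric \<Rightarrow> 'b metric \<Rightarrow> ennreal" where
  "dGHc X Y =
     (INF f\<in>{f. continuous_map (mtopology_of X) (mtopology_of Y) f}.
      INF g\<in>{g. continuous_map (mtopology_of Y) (mtopology_of X) g}.
        max (dis X Y f) (max (dis Y X g) (codis X Y f g))) / 2"

(* Powers with a positive real exponent on [0, \<infinity>]; not meant for exponents \<le> 0. *)
definition epowr :: "ennreal \<Rightarrow> real \<Rightarrow> ennreal" where
  "epowr x p = (if x = top then top else ennreal (enn2real x powr p))"

definition lp_dist :: "real \<Rightarrow> (nat \<Rightarrow> 'a metric) \<Rightarrow> (nat \<Rightarrow> 'a) \<Rightarrow> (nat \<Rightarrow> 'a) \<Rightarrow> real" where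
  "lp_dist p X x y = (\<Sum>n. mdist (X n) (x n) (y n) powr p) powr (1 / p)"

(* Meaningful if p \<ge> 1 and the p-th powers of the diameters are summable: then the series in
   lp_dist converges and lp_dist is a metric (lemma Metric_space_lp_prod). *)
definition lp_prod :: "real \<Rightarrow> (nat \<Rightarrow> 'a metric) \<Rightarrow> (nat \<Rightarrow> 'a) metric" where
  "lp_prod p X = metric (\<Pi>\<^sub>E n\<in>UNIV. mspace (X n), lp_dist p X)"

lemma powr_convex_nonneg:
  fixes x y t p :: real
  assumes p: "p \<ge> 1" and x: "x \<ge> 0" and y: "y \<ge> 0" and t: "0 < t" "t < 1"
  shows "(t * x + (1 - t) * y) powr p \<le> t * x powr p + (1 - t) * y powr p"
proof -
  have small: "s powr p \<le> s" if "0 < s" "s < 1" for s :: real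
    using powr_mono'[of 1 p s] that p by simp
  consider "x = 0" | "y = 0" | "x > 0" "y > 0" using x y by linarith
  then show ?thesis
  proof cases
    case 1
    then show ?thesis
      using small[of "1 - t"] t y by (simp add: powr_mult mult_right_mono)
  next
    case 2
    then show ?thesis
      using small[of t] t x by (simp add: powr_mult mult_right_mono)
  next
    case 3
    then show ?thesis
      using convex_onD[OF powr_convex[OF p], of "1 - t" x y] t by simp
  qed
qed

lemma lp_minkowski:
  fixes a b :: "nat \<Rightarrow> real"
  assumes p: "p \<ge> 1" and a: "\<And>n. a n \<ge> 0" and b: "\<And>n. b n \<ge> 0"
    and sa: "summable (\<lambda>n. a n powr p)" and sb: "summable (\<lambda>n. b n powr p)"
  shows "summable (\<lambda>n. (a n + b n) powr p)"
    and "(\<Sum>n. (a n + b n) powr p) powr (1 / p)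
           \<le> (\<Sum>n. a n powr p) powr (1 / p) + (\<Sum>n. b n powr p) powr (1 / p)"
proof -
  let ?A = "(\<Sum>n. a n powr p)" and ?B = "(\<Sum>n. b n powr p)"
  have A0: "?A \<ge> 0" and B0: "?B \<ge> 0"
    by (auto intro!: suminf_nonneg sa sb)
  have key: "summable (\<lambda>n. (a n + b n) powr p) \<and>
    (\<Sum>n. (a n + b n) powr p) powr (1 / p) \<le> ?A powr (1 / p) + ?B powr (1 / p) + 2 * e"
    if e: "e > 0" for e :: real
  proof -
    define A where "A = ?A powr (1 / p) + e"
    define B where "B = ?B powr (1 / p) + e"
    define t where "t = A / (A + B)"
    have A: "A > 0" and B: "B > 0" using e by (auto simp: A_def B_def add_nonneg_pos)
    have t: "0 < t" "t < 1" using A B by (auto simp: t_def)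
    have tA: "t / A = 1 / (A + B)" and tB: "(1 - t) / B = 1 / (A + B)"
    proof -
      have "1 - t = B / (A + B)" using A B by (simp add: t_def diff_divide_eq_iff)
      then show "(1 - t) / B = 1 / (A + B)" using B by simp
      show "t / A = 1 / (A + B)" using A by (simp add: t_def)
    qed
    have leA: "?A / A powr p \<le> 1"
    proof -
      have "(?A powr (1 / p)) powr p \<le> A powr p"
        using e p by (intro powr_mono2) (auto simp: A_def)
      then show ?thesis using A A0 p by (simp add: powr_powr)
    qed
    have leB: "?B / B powr p \<le> 1"
    proof -
      have "(?B powr (1 / p)) powr p \<le> B powr p"
        using e p by (intro powr_mono2) (auto simp: B_def)
      then show ?thesis using B B0 p by (simp add: powr_powr)
    qed
    define C where "C = (A + B) powr p"
    let ?h = "\<lambda>n. C * (t / A powr p * a n powr p + (1 - t) / B powr p * b n powr p)"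
    have le: "(a n + b n) powr p \<le> ?h n" for n
    proof -
      have "t * (a n / A) + (1 - t) * (b n / B) = (a n + b n) / (A + B)"
        using tA tB by (metis add_divide_distrib mult.commute times_divide_eq_left
            times_divide_eq_right mult_1)
      then have "((a n + b n) / (A + B)) powr p
          \<le> t * (a n / A) powr p + (1 - t) * (b n / B) powr p"
        using powr_convex_nonneg[OF p _ _ t, of "a n / A" "b n / B"] a[of n] b[of n] A B by simp
      then show ?thesis
        using a[of n] b[of n] A B by (simp add: C_def powr_divide field_simps)
    qed
    have sh: "summable ?h" using sa sb by (intro summable_mult summable_add)
    have s: "summable (\<lambda>n. (a n + b n) powr p)"
      by (rule summable_comparison_test'[OF sh, of 0]) (use le in auto)
    have "(\<Sum>n. (a n + b n) powr p) \<le> suminf ?h"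
      by (intro suminf_le le s sh)
    also have "suminf ?h = C * (t * (?A / A powr p) + (1 - t) * (?B / B powr p))"
    proof -
      have "?h sums (C * (t / A powr p * ?A + (1 - t) / B powr p * ?B))"
        by (intro sums_mult sums_add summable_sums sa sb)
      then show ?thesis by (simp add: sums_iff)
    qed
    also have "\<dots> \<le> C * (t * 1 + (1 - t) * 1)"
      using leA leB t by (intro mult_left_mono add_mono) (auto simp: C_def)
    finally have "(\<Sum>n. (a n + b n) powr p) \<le> (A + B) powr p" by (simp add: C_def)
    then have "(\<Sum>n. (a n + b n) powr p) powr (1 / p) \<le> ((A + B) powr p) powr (1 / p)"
      using p by (intro powr_mono2 suminf_nonneg s) auto
    also have "\<dots> = A + B" using A B p by (simp add: powr_powr)
    finally show ?thesis using s by (simp add: A_def B_def)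
  qed
  show "summable (\<lambda>n. (a n + b n) powr p)" using key[of 1] by simp
  show "(\<Sum>n. (a n + b n) powr p) powr (1 / p) \<le> ?A powr (1 / p) + ?B powr (1 / p)"
  proof (rule field_le_epsilon)
    fix e :: real assume "e > 0"
    then show "(\<Sum>n. (a n + b n) powr p) powr (1 / p) \<le> ?A powr (1 / p) + ?B powr (1 / p) + e"
      using key[of "e / 2"] by simp
  qed
qed

lemma summable_lp_dist:
  assumes p: "p > 0" and fin: "(\<Sum>n. epowr (mdiam (X n)) p) < \<infinity>"
    and x: "x \<in> (\<Pi>\<^sub>E n\<in>UNIV. mspace (X n))" and y: "y \<in> (\<Pi>\<^sub>E n\<in>UNIV. mspace (X n))"
  shows "summable (\<lambda>n. mdist (X n) (x n) (y n) powr p)"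
proof (rule summable_suminf_not_top)
  have le: "ennreal (mdist (X n) (x n) (y n) powr p) \<le> epowr (mdiam (X n)) p" for n
  proof (cases "mdiam (X n) = top")
    case False
    have "ennreal (mdist (X n) (x n) (y n)) \<le> mdiam (X n)"
      unfolding mdiam_def using x y by (intro SUP_upper2[of "x n"] SUP_upper) auto
    then have "mdist (X n) (x n) (y n) \<le> enn2real (mdiam (X n))"
      using False by (metis enn2real_ennreal enn2real_mono mdist_nonneg top.not_eq_extremum)
    then show ?thesis
      using False p by (auto simp: epowr_def intro!: ennreal_leI powr_mono2)
  qed (simp add: epowr_def)
  then have "(\<Sum>n. ennreal (mdist (X n) (x n) (y n) powr p)) \<le> (\<Sum>n. epowr (mdiam (X n)) p)"
    by (intro suminf_le) auto
  then show "(\<Sum>n. ennreal (mdist (X n) (x n) (y n) powr p)) \<noteq> top"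
    using fin by (auto simp: top_unique)
qed simp

lemma Metric_space_lp_prod:
  assumes p: "p \<ge> 1" and fin: "(\<Sum>n. epowr (mdiam (X n)) p) < \<infinity>"
  shows "Metric_space (\<Pi>\<^sub>E n\<in>UNIV. mspace (X n)) (lp_dist p X)"
proof
  let ?M = "\<Pi>\<^sub>E n\<in>UNIV. mspace (X n)"
  have p0: "p > 0" using p by simp
  note sm = summable_lp_dist[OF p0 fin]
  show "0 \<le> lp_dist p X x y" for x y by (simp add: lp_dist_def)
  show "lp_dist p X x y = lp_dist p X y x" for x y by (simp add: lp_dist_def mdist_commute)
  show "lp_dist p X x y = 0 \<longleftrightarrow> x = y" if x: "x \<in> ?M" and y: "y \<in> ?M" for x y
  proof -
    have "lp_dist p X x y = 0 \<longleftrightarrow> (\<forall>n. mdist (X n) (x n) (y n) powr p = 0)"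
      by (simp add: lp_dist_def suminf_eq_zero_iff[OF sm[OF x y]])
    also have "\<dots> \<longleftrightarrow> (\<forall>n. x n = y n)" using x y by (auto simp: PiE_iff)
    finally show ?thesis by (simp add: fun_eq_iff)
  qed
  show "lp_dist p X x z \<le> lp_dist p X x y + lp_dist p X y z"
    if x: "x \<in> ?M" and y: "y \<in> ?M" and z: "z \<in> ?M" for x y z
  proof -
    note mk = lp_minkowski[OF p mdist_nonneg mdist_nonneg sm[OF x y] sm[OF y z]]
    have "mdist (X n) (x n) (z n) \<le> mdist (X n) (x n) (y n) + mdist (X n) (y n) (z n)" for n
      using x y z by (intro mdist_triangle) auto
    then have "(\<Sum>n. mdist (X n) (x n) (z n) powr p)
        \<le> (\<Sum>n. (mdist (X n) (x n) (y n) + mdist (X n) (y n) (z n)) powr p)"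
      using p by (intro suminf_le mk(1) sm[OF x z] powr_mono2) auto
    then have "lp_dist p X x z
        \<le> (\<Sum>n. (mdist (X n) (x n) (y n) + mdist (X n) (y n) (z n)) powr p) powr (1 / p)"
      unfolding lp_dist_def using p
      by (intro powr_mono2 suminf_nonneg sm[OF x z]) auto
    with mk(2) show ?thesis by (simp add: lp_dist_def)
  qed
qed

lemma
  assumes "p \<ge> 1" and "(\<Sum>n. epowr (mdiam (X n)) p) < \<infinity>"
  shows mspace_lp_prod: "mspace (lp_prod p X) = (\<Pi>\<^sub>E n\<in>UNIV. mspace (X n))"
    and mdist_lp_prod: "mdist (lp_prod p X) = lp_dist p X"
  using Metric_space_lp_prod[OF assms]
  by (simp_all add: lp_prod_def Metric_space.mspace_metric Metric_space.mdist_metric)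

end

theory Submission
  imports Defs
begin

text \<open>
  Coordinatewise maps do the job. If \<open>f n\<close> and \<open>g n\<close> are continuous maps between \<open>X n\<close> and
  \<open>Y n\<close> whose distortions and codistortion are at most \<open>2 * t n\<close>, let \<open>F\<close> and \<open>G\<close> be
  their products. Any of the differences that enter the distortions and the codistortion of \<open>F\<close>
  and \<open>G\<close> is a difference of two \<open>l\<^sup>p\<close>-norms of sequences that are \<open>2 * t n\<close>-close in coordinate
  \<open>n\<close>, so by Minkowski's inequality (\<open>lp_norm_diff_le\<close>) it is at most twice the \<open>l\<^sup>p\<close>-norm
  of \<open>t\<close>.

  The products \<open>F\<close> and \<open>G\<close> are continuous because summability of the \<open>p\<close>-th powers of the
  diameters makes the tails of the series for the \<open>l\<^sup>p\<close>-distance uniformly small: the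
  \<open>l\<^sup>p\<close>-product carries the product topology, and a map into it is continuous as soon as its
  coordinates are (\<open>continuous_map_into_lp_prod\<close>).

  The infimum in the definition of \<open>dGHc\<close> need not be attained, so \<open>t n\<close> exceeds
  \<open>dGHc (X n) (Y n)\<close> by an error. These errors are chosen to have \<open>l\<^sup>p\<close>-norm \<open>e\<close>; Minkowski's
  inequality bounds the norm of \<open>t\<close> by the desired norm plus \<open>e\<close>, and \<open>e\<close> is arbitrary.
\<close>

section \<open>The distance as an infimum over pairs of almost inverse maps\<close>

text \<open>
  For \<open>t \<ge> 0\<close> these pointwise bounds say that the two distortions and the codistortion are at most
  \<open>2 * t\<close>. Unlike the suprema, they pass directly to products.
\<close>

definition gh_close :: "'a metric \<Rightarrow> 'b metric \<Rightarrow> ('a \<Rightarrow> 'b) \<Rightarrow> ('b \<Rightarrow> 'a) \<Rightarrow> real \<Rightarrow> bool" where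
  "gh_close X Y f g t \<longleftrightarrow>
     (\<forall>x\<in>mspace X. \<forall>x'\<in>mspace X. \<bar>mdist X x x' - mdist Y (f x) (f x')\<bar> \<le> 2 * t) \<and>
     (\<forall>y\<in>mspace Y. \<forall>y'\<in>mspace Y. \<bar>mdist Y y y' - mdist X (g y) (g y')\<bar> \<le> 2 * t) \<and>
     (\<forall>x\<in>mspace X. \<forall>y\<in>mspace Y. \<bar>mdist X x (g y) - mdist Y (f x) y\<bar> \<le> 2 * t)"

lemma gh_close_iff:
  assumes "t \<ge> 0"
  shows "gh_close X Y f g t \<longleftrightarrow>
    max (dis X Y f) (max (dis Y X g) (codis X Y f g)) \<le> ennreal (2 * t)"
  using assms by (simp add: gh_close_def dis_def codis_def SUP_le_iff)

lemma dGHc_le: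
  assumes "continuous_map (mtopology_of X) (mtopology_of Y) f"
    and "continuous_map (mtopology_of Y) (mtopology_of X) g"
    and "gh_close X Y f g t" and t: "t \<ge> 0"
  shows "dGHc X Y \<le> ennreal t"
proof -
  have "dGHc X Y \<le> max (dis X Y f) (max (dis Y X g) (codis X Y f g)) / 2"
    unfolding dGHc_def using assms
    by (intro divide_right_mono_ennreal INF_lower2[of f] INF_lower2[of g]) auto
  also have "\<dots> \<le> ennreal (2 * t) / 2"
    using assms by (intro divide_right_mono_ennreal) (simp add: gh_close_iff)
  also have "\<dots> = ennreal t"
    using divide_ennreal[of "2 * t" 2] t by simp
  finally show ?thesis .
qed

lemma dGHc_lessD:
  assumes "dGHc X Y < ennreal t" and t: "t \<ge> 0"
  obtains f g where "continuous_map (mtopology_of X) (mtopology_of Y) f"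
    and "continuous_map (mtopology_of Y) (mtopology_of X) g"
    and "gh_close X Y f g t"
proof -
  let ?I = "INF f\<in>{f. continuous_map (mtopology_of X) (mtopology_of Y) f}.
      INF g\<in>{g. continuous_map (mtopology_of Y) (mtopology_of X) g}.
        max (dis X Y f) (max (dis Y X g) (codis X Y f g))"
  have "?I < ennreal (2 * t)"
  proof (rule ccontr)
    assume "\<not> ?I < ennreal (2 * t)"
    then have "ennreal (2 * t) / 2 \<le> dGHc X Y"
      unfolding dGHc_def by (intro divide_right_mono_ennreal) (simp add: not_less)
    moreover have "ennreal (2 * t) / 2 = ennreal t"
      using divide_ennreal[of "2 * t" 2] t by simp
    ultimately show False using assms by simp
  qed
  then obtain f g where "continuous_map (mtopology_of X) (mtopology_of Y) f"
    and "continuous_map (mtopology_of Y) (mtopology_of X) g"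
    and "max (dis X Y f) (max (dis Y X g) (codis X Y f g)) < ennreal (2 * t)"
    unfolding INF_less_iff by blast
  with that t show ?thesis by (metis gh_close_iff less_imp_le)
qed

section \<open>Norms of coordinatewise close sequences\<close>

text \<open>
  Minkowski's inequality applied to \<open>a \<le> b + c\<close> and to \<open>b \<le> a + c\<close>; stated with \<open>c\<close> in place of
  \<open>\<bar>a - b\<bar>\<close> because \<open>c\<close> is the sequence whose norm is controlled below.
\<close>

lemma lp_norm_diff_le:
  fixes a b c :: "nat \<Rightarrow> real"
  assumes p: "p \<ge> 1" and nn: "\<And>n. a n \<ge> 0" "\<And>n. b n \<ge> 0"
    and sm: "summable (\<lambda>n. a n powr p)" "summable (\<lambda>n. b n powr p)" "summable (\<lambda>n. c n powr p)"
    and close: "\<And>n. \<bar>a n - b n\<bar> \<le> c n"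
  shows "\<bar>(\<Sum>n. a n powr p) powr (1 / p) - (\<Sum>n. b n powr p) powr (1 / p)\<bar>
    \<le> (\<Sum>n. c n powr p) powr (1 / p)"
proof -
  have c: "c n \<ge> 0" for n using close[of n] by linarith
  have le: "(\<Sum>n. u n powr p) powr (1 / p)
      \<le> (\<Sum>n. v n powr p) powr (1 / p) + (\<Sum>n. c n powr p) powr (1 / p)"
    if u: "\<And>n. u n \<ge> 0" "summable (\<lambda>n. u n powr p)"
      and v: "\<And>n. v n \<ge> 0" "summable (\<lambda>n. v n powr p)"
      and uv: "\<And>n. u n \<le> v n + c n" for u v :: "nat \<Rightarrow> real"
  proof -
    note mk = lp_minkowski[OF p v(1) c v(2) sm(3)]
    have "(\<Sum>n. u n powr p) \<le> (\<Sum>n. (v n + c n) powr p)"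
      using p u uv by (intro suminf_le mk(1) powr_mono2) auto
    then have "(\<Sum>n. u n powr p) powr (1 / p) \<le> (\<Sum>n. (v n + c n) powr p) powr (1 / p)"
      using p by (intro powr_mono2 suminf_nonneg u) auto
    with mk(2) show ?thesis by linarith
  qed
  have "a n \<le> b n + c n" "b n \<le> a n + c n" for n using close[of n] by linarith+
  then show ?thesis
    using le[of a b] le[of b a] nn sm by (simp add: abs_le_iff)
qed

section \<open>The topology of the product\<close>

lemma coordinate_dist_le_lp_dist:
  assumes p: "p > 0" and "(\<Sum>n. epowr (mdiam (X n)) p) < \<infinity>"
    and "x \<in> (\<Pi>\<^sub>E n\<in>UNIV. mspace (X n))" and "y \<in> (\<Pi>\<^sub>E n\<in>UNIV. mspace (X n))"
  shows "mdist (X n) (x n) (y n) \<le> lp_dist p X x y"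
proof -
  have "mdist (X n) (x n) (y n) powr p \<le> (\<Sum>n. mdist (X n) (x n) (y n) powr p)"
    using sum_le_suminf[OF summable_lp_dist[OF assms], of "{n}"] by simp
  then have "(mdist (X n) (x n) (y n) powr p) powr (1 / p) \<le> lp_dist p X x y"
    unfolding lp_dist_def using p by (intro powr_mono2) auto
  then show ?thesis using p by (simp add: powr_powr)
qed

lemma continuous_map_lp_prod_coordinate:
  assumes p: "p \<ge> 1" and fin: "(\<Sum>n. epowr (mdiam (X n)) p) < \<infinity>"
  shows "continuous_map (mtopology_of (lp_prod p X)) (mtopology_of (X n)) (\<lambda>x. x n)"
proof (rule Lipschitz_continuous_imp_continuous_map)
  have "mdist (X n) (x n) (y n) \<le> 1 * mdist (lp_prod p X) x y"
    if "x \<in> mspace (lp_prod p X)" "y \<in> mspace (lp_prod p X)" for x y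
    using coordinate_dist_le_lp_dist[of p X x y n] that p fin
    by (simp add: mspace_lp_prod mdist_lp_prod)
  then show "Lipschitz_continuous_map (lp_prod p X) (X n) (\<lambda>x. x n)"
    using p fin unfolding Lipschitz_continuous_map_def
    by (auto simp: mspace_lp_prod intro!: exI[of _ 1])
qed

lemma mdist_powr_le_epowr_mdiam:
  assumes "p > 0" and fin: "epowr (mdiam X) p \<noteq> \<infinity>" and "x \<in> mspace X" "y \<in> mspace X"
  shows "mdist X x y powr p \<le> enn2real (epowr (mdiam X) p)"
proof -
  have ne: "mdiam X \<noteq> \<infinity>" using fin by (auto simp: epowr_def)
  have "ennreal (mdist X x y) \<le> mdiam X"
    unfolding mdiam_def using assms by (intro SUP_upper2[of x] SUP_upper) auto
  then have "mdist X x y \<le> enn2real (mdiam X)"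
    using ne by (metis enn2real_ennreal enn2real_mono mdist_nonneg top.not_eq_extremum
        infinity_ennreal_def)
  then show ?thesis using assms ne by (auto simp: epowr_def intro!: powr_mono2)
qed

text \<open>
  Split the series for the distance at an index beyond which the diameters alone contribute less
  than half of the allowed \<open>p\<close>-th power; continuity of the finitely many remaining coordinates
  controls the rest.
\<close>

lemma continuous_map_into_lp_prod:
  assumes p: "p \<ge> 1" and fin: "(\<Sum>n. epowr (mdiam (X n)) p) < \<infinity>"
    and cont: "\<And>n. continuous_map T (mtopology_of (X n)) (\<lambda>z. h z n)"
  shows "continuous_map T (mtopology_of (lp_prod p X)) h"
  unfolding mtopology_of_def
    Metric_space.continuous_map_to_metric[OF Metric_space_mspace_mdist]
proof (intro ballI allI impI)
  fix x and e :: real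
  assume x: "x \<in> topspace T" and e: "0 < e"
  have p0: "p > 0" using p by simp
  have coord: "h z n \<in> mspace (X n)" if "z \<in> topspace T" for z n
    using continuous_map_image_subset_topspace[OF cont[of n]] that by auto
  have inP: "h z \<in> (\<Pi>\<^sub>E n\<in>UNIV. mspace (X n))" if "z \<in> topspace T" for z
    using coord[OF that] by auto
  define D where "D n = enn2real (epowr (mdiam (X n)) p)" for n
  have finn: "epowr (mdiam (X n)) p \<noteq> \<infinity>" for n
    using ennreal_suminf_lessD[OF fin[unfolded infinity_ennreal_def], of n] by auto
  have smD: "summable D"
  proof (rule summable_suminf_not_top)
    show "(\<Sum>n. ennreal (D n)) \<noteq> top"
      using fin finn by (simp add: D_def less_top)
  qed (simp add: D_def)
  define E where "E = e powr p"
  have E: "E > 0" using e by (simp add: E_def)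
  obtain N where N: "norm (\<Sum>i. D (i + N)) < E / 2"
    using suminf_exist_split[OF _ smD, of "E / 2"] E by auto
  \<comment> \<open>The radius makes each of the first \<open>N\<close> summands at most \<open>E / (2 * (N + 1))\<close>; the shift by
    one covers \<open>N = 0\<close>.\<close>
  define \<delta> where "\<delta> = (E / (2 * (real N + 1))) powr (1 / p)"
  have \<delta>: "\<delta> > 0" using E by (simp add: \<delta>_def)
  have \<delta>p: "\<delta> powr p = E / (2 * (real N + 1))" using E p0 by (simp add: \<delta>_def powr_powr)
  define U where "U = topspace T \<inter> (\<Inter>n<N. {z \<in> topspace T. h z n \<in>
    Metric_space.mball (mspace (X n)) (mdist (X n)) (h x n) \<delta>})"
  have ball: "w \<in> Metric_space.mball (mspace (X n)) (mdist (X n)) (h x n) \<delta> \<longleftrightarrow>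
      h x n \<in> mspace (X n) \<and> w \<in> mspace (X n) \<and> mdist (X n) (h x n) w < \<delta>" for n w
    by (rule Metric_space.in_mball[OF Metric_space_mspace_mdist])
  have "openin T {z \<in> topspace T. h z n \<in>
      Metric_space.mball (mspace (X n)) (mdist (X n)) (h x n) \<delta>}" for n
    using cont[of n] Metric_space.openin_mball[OF Metric_space_mspace_mdist]
    unfolding mtopology_of_def by (rule openin_continuous_map_preimage)
  then have "openin T U"
    by (cases "N = 0") (auto simp: U_def)
  moreover have "x \<in> U"
    using x coord[OF x] \<delta>
    by (simp add: U_def Metric_space.centre_in_mball_iff[OF Metric_space_mspace_mdist])
  moreover have "h z \<in> Metric_space.mball (mspace (lp_prod p X)) (mdist (lp_prod p X)) (h x) e"
    if z: "z \<in> U" for z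
  proof -
    have zT: "z \<in> topspace T" using z by (simp add: U_def)
    let ?d = "\<lambda>n. mdist (X n) (h x n) (h z n) powr p"
    have smd: "summable ?d" by (rule summable_lp_dist[OF p0 fin inP[OF x] inP[OF zT]])
    have "(\<Sum>n<N. ?d n) \<le> (\<Sum>n<N. E / (2 * (real N + 1)))"
    proof (rule sum_mono)
      fix n assume "n \<in> {..<N}"
      then have "mdist (X n) (h x n) (h z n) \<le> \<delta>"
        using z by (auto simp: U_def ball intro: less_imp_le)
      then have "?d n \<le> \<delta> powr p" using p0 by (intro powr_mono2) auto
      then show "?d n \<le> E / (2 * (real N + 1))" by (simp add: \<delta>p)
    qed
    also have "\<dots> \<le> E / 2" using E by (simp add: field_simps)
    finally have head: "(\<Sum>n<N. ?d n) \<le> E / 2" .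
    have "(\<Sum>n. ?d (n + N)) \<le> (\<Sum>n. D (n + N))"
      using mdist_powr_le_epowr_mdiam[OF p0 finn coord[OF x] coord[OF zT]]
      by (intro suminf_le summable_ignore_initial_segment[OF smd]
          summable_ignore_initial_segment[OF smD]) (simp add: D_def)
    also have "\<dots> < E / 2" using N by simp
    finally have "(\<Sum>n. ?d n) < E"
      using head suminf_split_initial_segment[OF smd, of N] by simp
    then have "(\<Sum>n. ?d n) powr (1 / p) < E powr (1 / p)"
      using p0 by (intro powr_less_mono2 suminf_nonneg smd) auto
    also have "\<dots> = e" using e p0 by (simp add: E_def powr_powr)
    finally have "lp_dist p X (h x) (h z) < e" by (simp add: lp_dist_def)
    then show ?thesis
      using inP[OF x] inP[OF zT]
      by (simp add: Metric_space.in_mball[OF Metric_space_lp_prod[OF p fin]]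
          mspace_lp_prod[OF p fin] mdist_lp_prod[OF p fin])
  qed
  ultimately show "\<exists>U. openin T U \<and> x \<in> U \<and>
      (\<forall>z\<in>U. h z \<in> Metric_space.mball (mspace (lp_prod p X)) (mdist (lp_prod p X)) (h x) e)"
    by blast
qed

lemma continuous_map_lp_prod_map:
  assumes p: "p \<ge> 1" and "(\<Sum>n. epowr (mdiam (X n)) p) < \<infinity>"
    and "(\<Sum>n. epowr (mdiam (Y n)) p) < \<infinity>"
    and f: "\<And>n. continuous_map (mtopology_of (X n)) (mtopology_of (Y n)) (f n)"
  shows "continuous_map (mtopology_of (lp_prod p X)) (mtopology_of (lp_prod p Y)) (\<lambda>x n. f n (x n))"
  using continuous_map_compose[OF continuous_map_lp_prod_coordinate f] assms
  by (intro continuous_map_into_lp_prod) (auto simp: o_def)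

section \<open>Products of almost inverse maps\<close>

text \<open>
  All three conditions compare the distance of two points of one product with the distance of two
  points of the other, so a single estimate (\<open>dist\<close>) serves for all of them. It rests on the fact
  that the same conditions hold in each coordinate.
\<close>

lemma gh_close_lp_prod:
  assumes p: "p \<ge> 1" and X: "(\<Sum>n. epowr (mdiam (X n)) p) < \<infinity>"
    and Y: "(\<Sum>n. epowr (mdiam (Y n)) p) < \<infinity>"
    and f: "\<And>n. f n \<in> mspace (X n) \<rightarrow> mspace (Y n)"
    and g: "\<And>n. g n \<in> mspace (Y n) \<rightarrow> mspace (X n)"
    and close: "\<And>n. gh_close (X n) (Y n) (f n) (g n) (t n)"
    and t: "\<And>n. t n \<ge> 0" "summable (\<lambda>n. t n powr p)"
  shows "gh_close (lp_prod p X) (lp_prod p Y) (\<lambda>x n. f n (x n)) (\<lambda>y n. g n (y n))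
    ((\<Sum>n. t n powr p) powr (1 / p))"
proof -
  have p0: "p > 0" using p by simp
  let ?PX = "\<Pi>\<^sub>E n\<in>UNIV. mspace (X n)" and ?PY = "\<Pi>\<^sub>E n\<in>UNIV. mspace (Y n)"
  have F: "(\<lambda>n. f n (x n)) \<in> ?PY" if "x \<in> ?PX" for x using that f by fastforce
  have G: "(\<lambda>n. g n (y n)) \<in> ?PX" if "y \<in> ?PY" for y using that g by fastforce
  have sm2: "summable (\<lambda>n. (2 * t n) powr p)"
    using t by (simp add: powr_mult summable_mult)
  have "(\<Sum>n. (2 * t n) powr p) powr (1 / p) = (2 powr p * (\<Sum>n. t n powr p)) powr (1 / p)"
    using t by (simp add: powr_mult suminf_mult)
  also have "\<dots> = 2 * (\<Sum>n. t n powr p) powr (1 / p)"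
    using p0 t by (simp add: powr_mult powr_powr suminf_nonneg)
  finally have two: "(\<Sum>n. (2 * t n) powr p) powr (1 / p) = 2 * (\<Sum>n. t n powr p) powr (1 / p)" .
  have dist: "\<bar>lp_dist p X x x' - lp_dist p Y y y'\<bar> \<le> 2 * (\<Sum>n. t n powr p) powr (1 / p)"
    if "x \<in> ?PX" "x' \<in> ?PX" "y \<in> ?PY" "y' \<in> ?PY"
      and "\<And>n. \<bar>mdist (X n) (x n) (x' n) - mdist (Y n) (y n) (y' n)\<bar> \<le> 2 * t n"
    for x x' y y'
    using lp_norm_diff_le[OF p mdist_nonneg mdist_nonneg summable_lp_dist[OF p0 X that(1,2)]
        summable_lp_dist[OF p0 Y that(3,4)] sm2 that(5)]
    by (simp add: two lp_dist_def)
  have closeD: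
    "x \<in> mspace (X n) \<Longrightarrow> x' \<in> mspace (X n) \<Longrightarrow>
      \<bar>mdist (X n) x x' - mdist (Y n) (f n x) (f n x')\<bar> \<le> 2 * t n"
    "y \<in> mspace (Y n) \<Longrightarrow> y' \<in> mspace (Y n) \<Longrightarrow>
      \<bar>mdist (X n) (g n y) (g n y') - mdist (Y n) y y'\<bar> \<le> 2 * t n"
    "x \<in> mspace (X n) \<Longrightarrow> y \<in> mspace (Y n) \<Longrightarrow>
      \<bar>mdist (X n) x (g n y) - mdist (Y n) (f n x) y\<bar> \<le> 2 * t n" for n x x' y y'
    using close[of n] by (simp_all add: gh_close_def abs_minus_commute)
  have "\<bar>lp_dist p X x x' - lp_dist p Y (\<lambda>n. f n (x n)) (\<lambda>n. f n (x' n))\<bar>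
      \<le> 2 * (\<Sum>n. t n powr p) powr (1 / p)" if "x \<in> ?PX" "x' \<in> ?PX" for x x'
    using that by (intro dist F closeD) auto
  moreover have "\<bar>lp_dist p Y y y' - lp_dist p X (\<lambda>n. g n (y n)) (\<lambda>n. g n (y' n))\<bar>
      \<le> 2 * (\<Sum>n. t n powr p) powr (1 / p)" if "y \<in> ?PY" "y' \<in> ?PY" for y y'
    unfolding abs_minus_commute[of "lp_dist p Y y y'"]
    using that by (intro dist G closeD) auto
  moreover have "\<bar>lp_dist p X x (\<lambda>n. g n (y n)) - lp_dist p Y (\<lambda>n. f n (x n)) y\<bar>
      \<le> 2 * (\<Sum>n. t n powr p) powr (1 / p)" if "x \<in> ?PX" "y \<in> ?PY" for x y
    using that by (intro dist F G closeD) auto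
  ultimately show ?thesis
    by (simp add: gh_close_def mspace_lp_prod[OF p X] mspace_lp_prod[OF p Y]
        mdist_lp_prod[OF p X] mdist_lp_prod[OF p Y])
qed

theorem theorem2p14:
  fixes p :: real
    and X :: "nat \<Rightarrow> 'a metric"
    and Y :: "nat \<Rightarrow> 'b metric"
  assumes "1 \<le> p"
    and "\<And>n. mspace (X n) \<noteq> {}"
    and "\<And>n. mspace (Y n) \<noteq> {}"
    and "(\<Sum>n. epowr (mdiam (X n)) p) < \<infinity>"
    and "(\<Sum>n. epowr (mdiam (Y n)) p) < \<infinity>"
  shows "dGHc (lp_prod p X) (lp_prod p Y) \<le> epowr (\<Sum>n. epowr (dGHc (X n) (Y n)) p) (1 / p)"
proof (cases "(\<Sum>n. epowr (dGHc (X n) (Y n)) p) = top")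
  case True
  then show ?thesis by (simp add: epowr_def)
next
  case fin: False
  have p0: "p > 0" using assms(1) by simp
  define s where "s n = enn2real (dGHc (X n) (Y n))" for n
  have "epowr (dGHc (X n) (Y n)) p < top" for n
    using fin by (intro ennreal_suminf_lessD[where f = "\<lambda>n. epowr (dGHc (X n) (Y n)) p"])
      (simp add: less_top)
  then have dfin: "dGHc (X n) (Y n) \<noteq> top" for n
    by (metis epowr_def less_irrefl)
  then have ep: "epowr (dGHc (X n) (Y n)) p = ennreal (s n powr p)" for n
    by (simp add: epowr_def s_def)
  have s: "s n \<ge> 0" for n by (simp add: s_def)
  have sms: "summable (\<lambda>n. s n powr p)"
    using fin by (intro summable_suminf_not_top) (simp_all add: ep)
  have rhs: "epowr (\<Sum>n. epowr (dGHc (X n) (Y n)) p) (1 / p)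
      = ennreal ((\<Sum>n. s n powr p) powr (1 / p))"
    unfolding ep using sms by (simp add: suminf_ennreal2 epowr_def suminf_nonneg)
  show ?thesis
    unfolding rhs
  proof (rule ennreal_le_epsilon)
    fix e :: real assume e: "0 < e"
    \<comment> \<open>The \<open>p\<close>-th powers of the errors form a geometric series with sum \<open>e powr p\<close>.\<close>
    define u where "u n = e * ((1 / 2) ^ Suc n) powr (1 / p)" for n
    have u: "u n > 0" for n using e by (simp add: u_def)
    have "u n powr p = e powr p * (1 / 2) ^ Suc n" for n
      using e p0 by (simp add: u_def powr_mult powr_powr del: power_Suc)
    then have su: "(\<lambda>n. u n powr p) sums (e powr p)"
      using sums_mult[OF power_half_series, of "e powr p"] by (simp del: power_Suc)
    have norm_u: "(\<Sum>n. u n powr p) powr (1 / p) = e"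
      using su e p0 by (simp add: sums_iff powr_powr)
    let ?t = "\<lambda>n. s n + u n"
    note mk = lp_minkowski[OF assms(1) s less_imp_le[OF u] sms sums_summable[OF su]]
    have t0: "?t n \<ge> 0" for n using s[of n] u[of n] by linarith
    have "\<exists>f g. continuous_map (mtopology_of (X n)) (mtopology_of (Y n)) f \<and>
        continuous_map (mtopology_of (Y n)) (mtopology_of (X n)) g \<and>
        gh_close (X n) (Y n) f g (?t n)" for n
    proof -
      have "dGHc (X n) (Y n) = ennreal (s n)" using dfin by (simp add: s_def less_top)
      also have "\<dots> < ennreal (?t n)"
        using s u[of n] by (intro ennreal_lessI) (auto simp: add_nonneg_pos)
      finally show ?thesis by (rule dGHc_lessD[OF _ t0]) blast
    qed
    then obtain f g where f: "continuous_map (mtopology_of (X n)) (mtopology_of (Y n)) (f n)"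
      and g: "continuous_map (mtopology_of (Y n)) (mtopology_of (X n)) (g n)"
      and close: "gh_close (X n) (Y n) (f n) (g n) (?t n)" for n
      by metis
    have maps: "f n \<in> mspace (X n) \<rightarrow> mspace (Y n)" "g n \<in> mspace (Y n) \<rightarrow> mspace (X n)" for n
      using continuous_map_funspace[OF f[of n]] continuous_map_funspace[OF g[of n]] by simp_all
    have "dGHc (lp_prod p X) (lp_prod p Y) \<le> ennreal ((\<Sum>n. ?t n powr p) powr (1 / p))"
      by (intro dGHc_le[OF continuous_map_lp_prod_map[OF assms(1,4,5) f]
          continuous_map_lp_prod_map[OF assms(1,5,4) g]
          gh_close_lp_prod[OF assms(1,4,5) maps close t0 mk(1)]]) simp
    also have "\<dots> \<le> ennreal ((\<Sum>n. s n powr p) powr (1 / p) + e)"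
      using mk(2) by (intro ennreal_leI) (simp add: norm_u)
    also have "\<dots> = ennreal ((\<Sum>n. s n powr p) powr (1 / p)) + ennreal e"
      using e by simp
    finally show "dGHc (lp_prod p X) (lp_prod p Y)
        \<le> ennreal ((\<Sum>n. s n powr p) powr (1 / p)) + ennreal e" .
  qed
qed

end
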